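(* For any integers $d,k\ge 1$, the Hamming graph $\mathbb{H}(d,k)$ satisfies $$\mathrm{tww}(\mathbb{H}(d,k))=\begin{cases}0 & \text{if } d=1 \text{ or } k=1,\\ 2(k-1)(d-2) & \text{if } d\ge 2 \text{ and } k=2,\\ 2(k-1)(d-1) & \text{if } d\ge 2 \text{ and } k\ge 3.\end{cases}$$
   Context: All graphs are finite and simple (no loops or multiple edges). $K_k$ is the complete graph on $k$ vertices. Twin-width. A trigraph $G$ has a vertex set $V(G)$, a set $E(G)$ of black edges and a set $R(G)$ of red edges, with $E(G)\cap R(G)=\emptyset$; a graph is a trigraph with no red edges. $N_G(v)$ is the set of vertices joined to $v$ by a black or red edge. A $d$-trigraph is a trigraph in which every vertex is incident with at most $d$ red edges. A contraction merges two distinct (not necessarily adjacent) vertices $u,v$ into a new vertex $w$: every vertex other than $u,v$ in $N_G(u)\triangle N_G(v)$ is joined to $w$ by a red edge; every $x\in N_G(u)\cap N_G(v)$ is joined to $w$ by a black edge if $ux,vx\in E(G)$ and by a red edge otherwise; all edges not incident with $u$ or $v$ are unchanged, and $u,v$ and their incident edges are removed. A $d$-sequence of an $n$-vertex graph $G$ is a sequence of $d$-trigraphs $G_n=G,G_{n-1},\dots,G_1=K_1$ with each $G_{i-1}$ obtained from $G_i$ by one contraction. The twin-width $\mathrm{tww}(G)$ is the least $d$ such that $G$ admits a $d$-sequence. Cartesian product. $G\,\square\,H$ has vertex set $V(G)\times V(H)$, and $(u,i)(v,j)$ is an edge iff [$u=v$ and $ij\in E(H)$] or [$i=j$ and $uv\in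 E(G)$]. Hamming graphs. $\mathbb{H}(1,k)=K_k$ and $\mathbb{H}(d,k)=K_k\,\square\,\mathbb{H}(d-1,k)$ for $d\ge2$. Equivalently, the vertex set is $\{0,\dots,k-1\}^d$ and two vertices are adjacent iff they differ in exactly one coordinate. *)

theory Defs
  imports Main
begin

section \<open>Finite simple graphs\<close>

record 'a sgraph =
  verts :: "'a set"
  edges :: "'a set set"

definition all_edges :: "'a set \<Rightarrow> 'a set set" where
  "all_edges V = {{u, v} | u v. u \<in> V \<and> v \<in> V \<and> u \<noteq> v}"

definition simple_graph :: "'a sgraph \<Rightarrow> bool" where
  "simple_graph G \<longleftrightarrow> finite (verts G) \<and> edges G \<subseteq> all_edges (verts G)"

definition complete_graph :: "'a set \<Rightarrow> 'a sgraph" where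
  "complete_graph V = \<lparr>verts = V, edges = all_edges V\<rparr>"

definition map_graph :: "('a \<Rightarrow> 'b) \<Rightarrow> 'a sgraph \<Rightarrow> 'b sgraph" where
  "map_graph f G = \<lparr>verts = f ` verts G, edges = (\<lambda>e. f ` e) ` edges G\<rparr>"

definition cartesian_product :: "'a sgraph \<Rightarrow> 'b sgraph \<Rightarrow> ('a \<times> 'b) sgraph" where
  "cartesian_product G H =
    \<lparr>verts = verts G \<times> verts H,
     edges = {{(u, i), (v, j)} | u i v j.
       (u, i) \<in> verts G \<times> verts H \<and> (v, j) \<in> verts G \<times> verts H \<and>
       ((u = v \<and> {i, j} \<in> edges H) \<or> (i = j \<and> {u, v} \<in> edges G))}\<rparr>"

section \<open>Hamming graphs\<close>

text \<open>The iterated product is transported along the injections \<open>i \<mapsto> [i]\<close> and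
  \<open>(i, xs) \<mapsto> i # xs\<close>, so that all the graphs have vertices of the same type.
  The value at \<open>d = 0\<close> is only there to make the function total.\<close>

fun hamming :: "nat \<Rightarrow> nat \<Rightarrow> nat list sgraph" where
  "hamming 0 k = complete_graph {[]}"
| "hamming (Suc 0) k = map_graph (\<lambda>i. [i]) (complete_graph {..<k})"
| "hamming (Suc (Suc d)) k =
     map_graph (\<lambda>(i, xs). i # xs)
       (cartesian_product (complete_graph {..<k}) (hamming (Suc d) k))"

section \<open>Trigraphs and twin-width\<close>

record 'a trigraph =
  tverts :: "'a set"
  black :: "'a set set"
  red :: "'a set set"

definition trigraph :: "'a trigraph \<Rightarrow> bool" where
  "trigraph T \<longleftrightarrow> finite (tverts T) \<and> black T \<subseteq> all_edges (tverts T) \<and>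
     red T \<subseteq> all_edges (tverts T) \<and> black T \<inter> red T = {}"

definition of_graph :: "'a sgraph \<Rightarrow> 'a trigraph" where
  "of_graph G = \<lparr>tverts = verts G, black = edges G, red = {}\<rparr>"

definition nbhd :: "'a trigraph \<Rightarrow> 'a \<Rightarrow> 'a set" where
  "nbhd T v = {x. {v, x} \<in> black T \<union> red T}"

definition d_trigraph :: "nat \<Rightarrow> 'a trigraph \<Rightarrow> bool" where
  "d_trigraph d T \<longleftrightarrow> trigraph T \<and> (\<forall>v \<in> tverts T. card {e \<in> red T. v \<in> e} \<le> d)"

definition contract :: "'a trigraph \<Rightarrow> 'a \<Rightarrow> 'a \<Rightarrow> 'a \<Rightarrow> 'a trigraph" where
  "contract T u v w =
    \<lparr>tverts = insert w (tverts T - {u, v}),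
     black = {e \<in> black T. u \<notin> e \<and> v \<notin> e} \<union>
       {{x, w} | x. x \<in> nbhd T u \<inter> nbhd T v \<and> {u, x} \<in> black T \<and> {v, x} \<in> black T},
     red = {e \<in> red T. u \<notin> e \<and> v \<notin> e} \<union>
       {{x, w} | x. x \<in> (nbhd T u - nbhd T v) \<union> (nbhd T v - nbhd T u) \<and> x \<noteq> u \<and> x \<noteq> v} \<union>
       {{x, w} | x. x \<in> nbhd T u \<inter> nbhd T v \<and> \<not> ({u, x} \<in> black T \<and> {v, x} \<in> black T)}\<rparr>"

text \<open>The merged vertex only has to differ from the vertices that survive: it may reuse
  the name \<open>u\<close> or \<open>v\<close>, as these are removed. Thus contractions exist over finite
  vertex types as well.\<close>

definition is_contraction :: "'a trigraph \<Rightarrow> 'a trigraph \<Rightarrow> bool" where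
  "is_contraction T T' \<longleftrightarrow>
     (\<exists>u v w. u \<in> tverts T \<and> v \<in> tverts T \<and> u \<noteq> v \<and> w \<notin> tverts T - {u, v} \<and>
        T' = contract T u v w)"

definition d_sequence :: "nat \<Rightarrow> 'a sgraph \<Rightarrow> (nat \<Rightarrow> 'a trigraph) \<Rightarrow> bool" where
  "d_sequence d G S \<longleftrightarrow>
     S (card (verts G)) = of_graph G \<and>
     (\<exists>x. S 1 = of_graph (complete_graph {x})) \<and>
     (\<forall>i \<in> {1..card (verts G)}. d_trigraph d (S i)) \<and>
     (\<forall>i \<in> {2..card (verts G)}. is_contraction (S i) (S (i - 1)))"

definition twin_width :: "'a sgraph \<Rightarrow> nat" where
  "twin_width G = (LEAST d. \<exists>S. d_sequence d G S)"

section \<open>Basic properties\<close>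

lemma all_edges_iff: "{x, y} \<in> all_edges V \<longleftrightarrow> x \<in> V \<and> y \<in> V \<and> x \<noteq> y"
  by (auto simp: all_edges_def doubleton_eq_iff)

lemma singleton_notin_all_edges: "{x} \<notin> all_edges V"
  by (auto simp: all_edges_def)

lemma all_edgesE:
  assumes "e \<in> all_edges V"
  obtains x y where "e = {x, y}" "x \<in> V" "y \<in> V" "x \<noteq> y"
  using assms by (auto simp: all_edges_def)

lemma verts_hamming: "verts (hamming d k) = {xs. length xs = d \<and> set xs \<subseteq> {..<k}}"
proof (induction d k rule: hamming.induct)
  case (2 k)
  show ?case
    by (auto simp: map_graph_def complete_graph_def length_Suc_conv)
next
  case (3 d k)
  show ?case
    by (auto simp: map_graph_def complete_graph_def cartesian_product_def 3 image_iff
        length_Suc_conv)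
qed (auto simp: complete_graph_def)

lemma edges_map_graph_iff:
  "e \<in> edges (map_graph f G) \<longleftrightarrow> (\<exists>e' \<in> edges G. e = f ` e')"
  by (auto simp: map_graph_def)

lemma card_Suc_filter:
  "card {i. i < Suc n \<and> P i} = (if P 0 then 1 else 0) + card {i. i < n \<and> P (Suc i)}"
proof -
  have "{i. i < Suc n \<and> P i} = (if P 0 then {0} else {}) \<union> Suc ` {i. i < n \<and> P (Suc i)}"
    by (auto simp: image_iff less_Suc_eq_0_disj)
  then show ?thesis
    by (auto simp: card_image card_insert_if)
qed

lemma differ_zero_iff:
  "length xs = n \<Longrightarrow> length ys = n \<Longrightarrow> card {i. i < n \<and> xs ! i \<noteq> ys ! i} = 0 \<longleftrightarrow> xs = ys"
  by (auto simp: list_eq_iff_nth_eq)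

lemma adjacent_hamming_Suc:
  assumes "a < k" "b < k" "xs \<in> verts (hamming (Suc d) k)" "ys \<in> verts (hamming (Suc d) k)"
  shows "{a # xs, b # ys} \<in> edges (hamming (Suc (Suc d)) k) \<longleftrightarrow>
    a = b \<and> {xs, ys} \<in> edges (hamming (Suc d) k) \<or> xs = ys \<and> a \<noteq> b"
    (is "?L \<longleftrightarrow> ?R")
proof
  assume ?L
  then obtain e where e: "e \<in> edges (cartesian_product (complete_graph {..<k}) (hamming (Suc d) k))"
      "{a # xs, b # ys} = (\<lambda>(i, xs). i # xs) ` e"
    unfolding hamming.simps(3) edges_map_graph_iff by blast
  then obtain u i v j where uv: "e = {(u, i), (v, j)}"
      "u = v \<and> {i, j} \<in> edges (hamming (Suc d) k) \<or> i = j \<and> u \<noteq> v"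
    unfolding cartesian_product_def by (auto simp only: complete_graph_def all_edges_iff sgraph.simps mem_Collect_eq)
  then have "{a # xs, b # ys} = {u # i, v # j}"
    using e(2) by simp
  then have "a = u \<and> xs = i \<and> b = v \<and> ys = j \<or> a = v \<and> xs = j \<and> b = u \<and> ys = i"
    by (simp only: doubleton_eq_iff list.inject conj_assoc)
  then show ?R
    using uv(2) by (metis insert_commute)
next
  assume ?R
  then have "{(a, xs), (b, ys)} \<in>
      edges (cartesian_product (complete_graph {..<k}) (hamming (Suc d) k))"
    using assms by (auto simp: cartesian_product_def complete_graph_def all_edges_iff)
  then show ?L
    unfolding hamming.simps(3) edges_map_graph_iff by (rule bexI[rotated]) simp
qed

lemma adjacent_hamming:
  assumes "d \<ge> 1" "xs \<in> verts (hamming d k)" "ys \<in> verts (hamming d k)"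
  shows "{xs, ys} \<in> edges (hamming d k) \<longleftrightarrow> card {i. i < d \<and> xs ! i \<noteq> ys ! i} = 1"
  using assms
proof (induction d arbitrary: xs ys)
  case (Suc d)
  obtain a xs' b ys' where xy: "xs = a # xs'" "ys = b # ys'" "a < k" "b < k"
    and v: "xs' \<in> verts (hamming d k)" "ys' \<in> verts (hamming d k)"
    using Suc.prems(2,3) unfolding verts_hamming by (cases xs; cases ys) simp_all
  have c: "card {i. i < Suc d \<and> xs ! i \<noteq> ys ! i} =
      (if a \<noteq> b then 1 else 0) + card {i. i < d \<and> xs' ! i \<noteq> ys' ! i}"
    using card_Suc_filter[of d "\<lambda>i. xs ! i \<noteq> ys ! i"] by (simp add: xy)
  have z: "card {i. i < d \<and> xs' ! i \<noteq> ys' ! i} = 0 \<longleftrightarrow> xs' = ys'"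
    using v by (intro differ_zero_iff) (auto simp: verts_hamming)
  show ?case
  proof (cases d)
    case 0
    then have "xs' = []" "ys' = []"
      using v unfolding verts_hamming by simp_all
    moreover have "{[a], [b]} \<in> edges (hamming (Suc 0) k) \<longleftrightarrow> a \<noteq> b"
    proof
      assume "{[a], [b]} \<in> edges (hamming (Suc 0) k)"
      then show "a \<noteq> b"
        unfolding hamming.simps(2) edges_map_graph_iff complete_graph_def sgraph.simps
        by (elim bexE all_edgesE) (simp add: doubleton_eq_iff, blast)
    next
      assume "a \<noteq> b"
      then have "{a, b} \<in> edges (complete_graph {..<k})"
        using xy(3,4) by (simp add: complete_graph_def all_edges_iff)
      then show "{[a], [b]} \<in> edges (hamming (Suc 0) k)"
        unfolding hamming.simps(2) edges_map_graph_iff by (rule bexI[rotated]) simp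
    qed
    ultimately show ?thesis
      unfolding c using 0 by (simp add: xy(1,2))
  next
    case (Suc m)
    have "{xs, ys} \<in> edges (hamming (Suc d) k) \<longleftrightarrow>
        a = b \<and> {xs', ys'} \<in> edges (hamming d k) \<or> xs' = ys' \<and> a \<noteq> b"
      using adjacent_hamming_Suc[OF xy(3,4) v[unfolded Suc]] unfolding Suc xy(1,2) .
    also have "{xs', ys'} \<in> edges (hamming d k) \<longleftrightarrow>
        card {i. i < d \<and> xs' ! i \<noteq> ys' ! i} = 1"
      using Suc v by (intro Suc.IH) simp_all
    finally show ?thesis
      unfolding c z[symmetric] by (cases "a = b") simp_all
  qed
qed simp

lemma simple_graph_map_graph:
  assumes "simple_graph G" "inj_on f (verts G)"
  shows "simple_graph (map_graph f G)"
  unfolding simple_graph_def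
proof (intro conjI subsetI)
  show "finite (verts (map_graph f G))"
    using assms(1) by (simp add: map_graph_def simple_graph_def)
  fix e assume "e \<in> edges (map_graph f G)"
  then obtain e' where e': "e' \<in> all_edges (verts G)" "e = f ` e'"
    using assms(1) by (auto simp: edges_map_graph_iff simple_graph_def)
  then obtain x y where "e = {f x, f y}" "x \<in> verts G" "y \<in> verts G" "x \<noteq> y"
    by (auto elim!: all_edgesE)
  then show "e \<in> all_edges (verts (map_graph f G))"
    using assms(2) by (simp add: all_edges_iff map_graph_def inj_on_eq_iff)
qed

lemma simple_graph_complete_graph: "finite V \<Longrightarrow> simple_graph (complete_graph V)"
  by (simp add: simple_graph_def complete_graph_def)

lemma simple_graph_cartesian_product:
  assumes "simple_graph G" "simple_graph H"
  shows "simple_graph (cartesian_product G H)"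
proof -
  have "{x, y} \<notin> edges G" if "x = y" for x y
    using assms(1) that singleton_notin_all_edges[of y] unfolding simple_graph_def by auto
  moreover have "{x, y} \<notin> edges H" if "x = y" for x y
    using assms(2) that singleton_notin_all_edges[of y] unfolding simple_graph_def by auto
  ultimately show ?thesis
    using assms by (auto simp: simple_graph_def cartesian_product_def all_edges_iff)
qed

lemma simple_graph_hamming: "simple_graph (hamming d k)"
proof (induction d k rule: hamming.induct)
  case (1 k)
  show ?case by (simp add: simple_graph_complete_graph)
next
  case (2 k)
  show ?case
    by (auto intro!: simple_graph_map_graph simple_graph_complete_graph simp: inj_on_def)
next
  case (3 d k)
  then show ?case
    unfolding hamming.simps(3)
    by (intro simple_graph_map_graph simple_graph_cartesian_product simple_graph_complete_graph)
      (auto simp: inj_on_def)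
qed

lemma trigraph_of_graph: "simple_graph G \<Longrightarrow> trigraph (of_graph G)"
  by (simp add: simple_graph_def trigraph_def of_graph_def)

lemma trigraph_contract:
  assumes T: "trigraph T" and "u \<in> tverts T" "v \<in> tverts T" "u \<noteq> v" "w \<notin> tverts T - {u, v}"
  shows "trigraph (contract T u v w)"
    and "card (tverts (contract T u v w)) = card (tverts T) - 1"
proof -
  have E: "black T \<union> red T \<subseteq> all_edges (tverts T)"
    using T by (auto simp: trigraph_def)
  have N: "x \<in> tverts T" "x \<noteq> y" if "x \<in> nbhd T y" for x y
  proof -
    have "{y, x} \<in> all_edges (tverts T)"
      using that E by (auto simp: nbhd_def)
    then show "x \<in> tverts T" "x \<noteq> y"
      by (auto simp: all_edges_iff)
  qed
  let ?A = "all_edges (insert w (tverts T - {u, v}))"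
  have old: "e \<in> ?A" "w \<notin> e"
    if "e \<in> black T \<union> red T" "u \<notin> e" "v \<notin> e" for e
  proof -
    from that(1) E obtain x y where e: "e = {x, y}" "x \<in> tverts T" "y \<in> tverts T" "x \<noteq> y"
      by (blast elim: all_edgesE)
    then show "e \<in> ?A" "w \<notin> e"
      using that(2,3) assms(5) by (auto simp: all_edges_iff)
  qed
  have new: "{x, w} \<in> ?A" if "x \<in> nbhd T u \<union> nbhd T v" "x \<noteq> u" "x \<noteq> v" for x
    using that N(1) assms(5) by (auto simp: all_edges_iff)
  have "black (contract T u v w) \<subseteq> ?A"
    using old(1) new N(2) by (auto simp: contract_def)
  moreover have "red (contract T u v w) \<subseteq> ?A"
    using old(1) new N(2) by (auto simp: contract_def)
  moreover have "black (contract T u v w) \<inter> red (contract T u v w) = {}"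
    using T old(2) by (auto simp: contract_def trigraph_def doubleton_eq_iff nbhd_def)
  ultimately show "trigraph (contract T u v w)"
    using T by (simp add: trigraph_def contract_def)
  have "card (tverts T - {u, v}) = card (tverts T) - 2"
    using assms by (simp add: card_Diff_subset trigraph_def)
  moreover have "card (tverts T) \<ge> 2"
    using assms card_mono[of "tverts T" "{u, v}"] by (simp add: trigraph_def)
  ultimately show "card (tverts (contract T u v w)) = card (tverts T) - 1"
    using T assms(5) by (simp add: contract_def trigraph_def)
qed

end

theory Submission
  imports Defs
begin

text \<open>
  Lower bound: two vertices of \<open>H(d, k)\<close> have degree \<open>d (k - 1)\<close> and at most \<open>k - 2\<close> common
  neighbours if they are adjacent, at most two otherwise. Counting the symmetric difference of
  their neighbourhoods shows that the very first contraction already creates a vertex of the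
  required red degree.

  Upper bound: view \<open>H(d, k)\<close> as the product of \<open>H(j, k)\<close> and \<open>H(d - j, k)\<close>, and collapse the first
  factor, performing each contraction on all copies of that factor before going on to the next.
  A part then sees at most two parts in each of the at most \<open>(d - j) (k - 1)\<close> neighbouring copies,
  in addition to its red neighbours inside its own copy. For \<open>j = 1\<close> (and \<open>j = 2\<close> if \<open>k = 2\<close>, where
  the factor is a 4-cycle) the factor collapses without red edges, which gives
  \<open>2 (d - j) (k - 1)\<close>. The remaining coordinates are collapsed one by one; there the \<open>k - 1\<close>
  possible red neighbours in the own copy are paid for by the smaller number of neighbouring copies.
\<close>

section \<open>Quotient trigraphs\<close>

text \<open>A partition is encoded by a map \<open>f\<close> on the vertices, whose fibres are the parts and whose
  values name the vertices of the quotient. The red edges of the quotient join the pairs of parts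
  that are neither completely joined nor without any edge between them.\<close>

definition full :: "'a sgraph \<Rightarrow> ('a \<Rightarrow> 'b) \<Rightarrow> 'b \<Rightarrow> 'b \<Rightarrow> bool" where
  "full G f a b \<longleftrightarrow> a \<in> f ` verts G \<and> b \<in> f ` verts G \<and> a \<noteq> b \<and>
     (\<forall>x \<in> verts G. \<forall>y \<in> verts G. f x = a \<longrightarrow> f y = b \<longrightarrow> {x, y} \<in> edges G)"

definition touching :: "'a sgraph \<Rightarrow> ('a \<Rightarrow> 'b) \<Rightarrow> 'b \<Rightarrow> 'b \<Rightarrow> bool" where
  "touching G f a b \<longleftrightarrow> a \<noteq> b \<and>
     (\<exists>x \<in> verts G. \<exists>y \<in> verts G. f x = a \<and> f y = b \<and> {x, y} \<in> edges G)"

definition mixed :: "'a sgraph \<Rightarrow> ('a \<Rightarrow> 'b) \<Rightarrow> 'b \<Rightarrow> 'b \<Rightarrow> bool" where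
  "mixed G f a b \<longleftrightarrow> touching G f a b \<and> \<not> full G f a b"

definition quotient :: "'a sgraph \<Rightarrow> ('a \<Rightarrow> 'b) \<Rightarrow> 'b trigraph" where
  "quotient G f = \<lparr>tverts = f ` verts G, black = {{a, b} | a b. full G f a b},
     red = {{a, b} | a b. mixed G f a b}\<rparr>"

definition red_degree_le :: "nat \<Rightarrow> 'a sgraph \<Rightarrow> ('a \<Rightarrow> 'b) \<Rightarrow> bool" where
  "red_degree_le r G f \<longleftrightarrow> (\<forall>a \<in> f ` verts G. card {b. mixed G f a b} \<le> r)"

lemma full_sym: "full G f a b \<longleftrightarrow> full G f b a"
proof -
  have "full G f b a" if "full G f a b" for a b
    using that unfolding full_def by (auto simp: doubleton_eq_iff) (metis insert_commute)
  then show ?thesis by blast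
qed

lemma touching_sym: "touching G f a b \<longleftrightarrow> touching G f b a"
proof -
  have "touching G f b a" if "touching G f a b" for a b
    using that unfolding touching_def by (metis doubleton_eq_iff)
  then show ?thesis by blast
qed

lemma mixed_sym: "mixed G f a b \<longleftrightarrow> mixed G f b a"
  by (simp add: mixed_def full_sym[of G f a] touching_sym[of G f a])

text \<open>The membership clauses of \<open>full\<close> make both fibres nonempty, so a complete
  pair really has an edge. Hence black or red adjacency in the quotient is exactly
  \<open>touching\<close>.\<close>

lemma full_touching: "full G f a b \<Longrightarrow> touching G f a b"
  unfolding full_def touching_def by blast

lemma mixedD:
  assumes "mixed G f a b"
  shows "a \<noteq> b" "a \<in> f ` verts G" "b \<in> f ` verts G"
    "\<exists>x \<in> verts G. \<exists>y \<in> verts G. f x = a \<and> f y = b \<and> {x, y} \<in> edges G"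
    "\<exists>x \<in> verts G. \<exists>y \<in> verts G. f x = a \<and> f y = b \<and> {x, y} \<notin> edges G"
  using assms unfolding mixed_def touching_def full_def by blast+

lemma pair_mem_Collect:
  assumes "\<And>a b. R a b \<Longrightarrow> R b a"
  shows "{a, b} \<in> {{a, b} | a b. R a b} \<longleftrightarrow> R a b"
  using assms by (auto simp: doubleton_eq_iff)

lemma pair_mem_black: "{a, b} \<in> black (quotient G f) \<longleftrightarrow> full G f a b"
  unfolding quotient_def trigraph.simps by (rule pair_mem_Collect) (metis full_sym)

lemma pair_mem_red: "{a, b} \<in> red (quotient G f) \<longleftrightarrow> mixed G f a b"
  unfolding quotient_def trigraph.simps by (rule pair_mem_Collect) (metis mixed_sym)

lemma nbhd_quotient: "nbhd (quotient G f) a = {b. touching G f a b}"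
  unfolding nbhd_def Un_iff pair_mem_black pair_mem_red mixed_def
  using full_touching[of G f a] by blast

lemma trigraph_quotient:
  assumes "finite (verts G)"
  shows "trigraph (quotient G f)"
proof -
  have "black (quotient G f) \<subseteq> all_edges (f ` verts G)"
    unfolding quotient_def all_edges_def full_def by auto
  moreover have "red (quotient G f) \<subseteq> all_edges (f ` verts G)"
    unfolding quotient_def all_edges_def mixed_def touching_def by force
  moreover have "e \<notin> red (quotient G f)" if e: "e \<in> black (quotient G f)" for e
  proof -
    obtain a b where "e = {a, b}"
      using e unfolding quotient_def by auto
    then show ?thesis
      using e by (simp add: pair_mem_black pair_mem_red mixed_def)
  qed
  then have "black (quotient G f) \<inter> red (quotient G f) = {}"
    by blast
  ultimately show ?thesis
    unfolding trigraph_def using assms by (simp add: quotient_def)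
qed

lemma d_trigraph_quotient:
  assumes "finite (verts G)" "red_degree_le r G f"
  shows "d_trigraph r (quotient G f)"
  unfolding d_trigraph_def
proof (intro conjI ballI trigraph_quotient[OF assms(1)])
  fix a assume "a \<in> tverts (quotient G f)"
  then have a: "card {b. mixed G f a b} \<le> r"
    using assms(2) by (auto simp: quotient_def red_degree_le_def)
  have fin: "finite {b. mixed G f a b}"
    by (rule finite_subset[of _ "f ` verts G"]) (use assms(1) mixedD(3) in auto)
  have "{e \<in> red (quotient G f). a \<in> e} \<subseteq> (\<lambda>b. {a, b}) ` {b. mixed G f a b}"
    unfolding quotient_def using mixed_sym[of G f] by (auto simp: image_iff insert_commute)
  then have "card {e \<in> red (quotient G f). a \<in> e} \<le> card {b. mixed G f a b}"
    using fin by (meson card_image_le card_mono finite_imageI order_trans)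
  then show "card {e \<in> red (quotient G f). a \<in> e} \<le> r"
    using a by simp
qed

text \<open>Brings the edges after merging \<open>b\<close> into \<open>a\<close> into the shape
  used by \<open>contract\<close>: old pairs avoiding both labels, plus the pairs at the surviving
  label. It serves black edges (\<open>full\<close>) and red edges (\<open>mixed\<close>)
  alike.\<close>

lemma pairs_after_merge:
  assumes "\<And>x y. R' x y \<Longrightarrow> R' y x" "\<And>x. \<not> R' x b" "\<not> R' a a"
    and "\<And>x y. x \<notin> {a, b} \<Longrightarrow> y \<notin> {a, b} \<Longrightarrow> R' x y \<longleftrightarrow> R x y"
  shows "{{x, y} | x y. R' x y} =
    {e \<in> {{x, y} | x y. R x y}. a \<notin> e \<and> b \<notin> e} \<union> {{x, a} | x. R' x a}"
proof (intro equalityI subsetI)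
  fix e assume "e \<in> {{x, y} | x y. R' x y}"
  then obtain x y where e: "e = {x, y}" "R' x y" by blast
  then have "x \<noteq> b" "y \<noteq> b" using assms(1,2) by blast+
  then show "e \<in> {e \<in> {{x, y} | x y. R x y}. a \<notin> e \<and> b \<notin> e} \<union> {{x, a} | x. R' x a}"
    using e assms(1)[OF e(2)] assms(4)[of x y] by (cases "x = a"; cases "y = a") auto
next
  fix e assume "e \<in> {e \<in> {{x, y} | x y. R x y}. a \<notin> e \<and> b \<notin> e} \<union> {{x, a} | x. R' x a}"
  then show "e \<in> {{x, y} | x y. R' x y}"
    using assms(4) by fastforce
qed

text \<open>The merged part is the union of two fibres: it is complete to a third part iff both
  fibres are, and touches it iff one of them does. This is the colouring rule for contractions. The
  merged vertex reuses the name \<open>a\<close>, as \<open>is_contraction\<close> permits.\<close>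

lemma contract_quotient:
  assumes "a \<in> f ` verts G" "b \<in> f ` verts G" "a \<noteq> b"
    and h: "\<forall>x \<in> verts G. h x = (if f x = b then a else f x)"
  shows "contract (quotient G f) a b a = quotient G h"
proof -
  have fl: "full G h x y \<longleftrightarrow> full G f x y" if "x \<notin> {a, b}" "y \<notin> {a, b}" for x y
    using that h unfolding full_def by (auto simp: image_iff split: if_splits)
  have tc: "touching G h x y \<longleftrightarrow> touching G f x y" if "x \<notin> {a, b}" "y \<notin> {a, b}" for x y
    using that h unfolding touching_def by (auto split: if_splits)
  have img: "h ` verts G = insert a (f ` verts G - {a, b})"
    using assms by (auto simp: image_iff split: if_splits)
  have fla: "full G h x a \<longleftrightarrow> full G f a x \<and> full G f b x" for x
    using assms(1-3) h img unfolding full_sym[of G h x] unfolding full_def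
    by (auto split: if_splits)
  have tca: "touching G h x a \<longleftrightarrow> x \<noteq> a \<and> x \<noteq> b \<and> (touching G f a x \<or> touching G f b x)" for x
    using assms(3) h unfolding touching_sym[of G h x] unfolding touching_def
    by (auto split: if_splits)
  have nb: "b \<notin> h ` verts G"
    using img assms(3) by auto
  have "black (contract (quotient G f) a b a) = black (quotient G h)"
  proof -
    have "black (quotient G h) =
        {e \<in> black (quotient G f). a \<notin> e \<and> b \<notin> e} \<union> {{x, a} | x. full G h x a}"
      unfolding quotient_def trigraph.simps
    proof (rule pairs_after_merge)
      show "full G h x y \<Longrightarrow> full G h y x" for x y
        by (simp add: full_sym)
      show "\<not> full G h x b" "\<not> full G h a a" for x
        using nb by (simp_all add: full_def)
    qed (rule fl)
    then show ?thesis
      unfolding contract_def trigraph.simps fla pair_mem_black nbhd_quotient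
      using full_touching[of G f] by auto
  qed
  moreover have "red (contract (quotient G f) a b a) = red (quotient G h)"
  proof -
    have r: "red (quotient G h) =
        {e \<in> red (quotient G f). a \<notin> e \<and> b \<notin> e} \<union> {{x, a} | x. mixed G h x a}"
      unfolding quotient_def trigraph.simps
    proof (rule pairs_after_merge)
      show "mixed G h x y \<longleftrightarrow> mixed G f x y" if "x \<notin> {a, b}" "y \<notin> {a, b}" for x y
        using that fl tc by (simp add: mixed_def)
      show "mixed G h x y \<Longrightarrow> mixed G h y x" for x y
        by (simp add: mixed_sym)
      show "\<not> mixed G h x b" "\<not> mixed G h a a" for x
        using nb mixedD(1,3)[of G h] by blast+
    qed
    \<comment> \<open>The two ways to become red: exactly one of the merged parts touches
      \<open>x\<close>, or both do but not both are complete to \<open>x\<close>.\<close>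
    have m: "mixed G h x a \<longleftrightarrow>
        x \<in> {x. touching G f a x} - {x. touching G f b x} \<union>
          ({x. touching G f b x} - {x. touching G f a x}) \<and> x \<noteq> a \<and> x \<noteq> b \<or>
        x \<in> {x. touching G f a x} \<inter> {x. touching G f b x} \<and> \<not> (full G f a x \<and> full G f b x)"
      for x
      unfolding mixed_def fla tca using full_touching[of G f] touching_def[of G f] by blast
    have u: "{{x, a} | x. mixed G h x a} =
        {{x, a} | x. x \<in> {x. touching G f a x} - {x. touching G f b x} \<union>
          ({x. touching G f b x} - {x. touching G f a x}) \<and> x \<noteq> a \<and> x \<noteq> b} \<union>
        {{x, a} | x. x \<in> {x. touching G f a x} \<inter> {x. touching G f b x} \<and>
          \<not> (full G f a x \<and> full G f b x)}"
      unfolding m by blast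
    show ?thesis
      unfolding contract_def trigraph.simps pair_mem_black nbhd_quotient r u Un_assoc ..
  qed
  ultimately show ?thesis
    using img by (simp add: contract_def quotient_def)
qed

text \<open>With singleton parts, a pair has only one candidate edge, so it cannot contain both an
  edge and a non-edge.\<close>

lemma of_graph_quotient:
  assumes "simple_graph G"
  shows "of_graph G = quotient G (\<lambda>x. x)"
proof -
  have *: "x \<in> verts G \<and> y \<in> verts G \<and> x \<noteq> y" if "{x, y} \<in> edges G" for x y
  proof -
    have "{x, y} \<in> all_edges (verts G)"
      using assms that by (auto simp: simple_graph_def)
    then show ?thesis by (simp add: all_edges_iff)
  qed
  have "full G (\<lambda>x. x) x y \<longleftrightarrow> {x, y} \<in> edges G" for x y
    using *[of x y] by (auto simp: full_def)
  moreover have "\<not> mixed G (\<lambda>x. x) x y" for x y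
    using mixedD(4,5)[of G "\<lambda>x. x" x y] by auto
  moreover have "edges G = {{x, y} | x y. {x, y} \<in> edges G}"
    using assms unfolding simple_graph_def by (fastforce elim: all_edgesE)
  ultimately show ?thesis
    by (simp add: of_graph_def quotient_def)
qed

section \<open>Sequences of merges\<close>

text \<open>Agreement is required on the vertices only, as other values do not affect the quotient.
  The red degree is checked for the result of each \<open>step\<close>, never for the initial
  labelling; where a bound for \<open>f\<close> matters, it is a separate hypothesis.\<close>

inductive merges_to :: "nat \<Rightarrow> 'a sgraph \<Rightarrow> ('a \<Rightarrow> 'b) \<Rightarrow> ('a \<Rightarrow> 'b) \<Rightarrow> bool"
  for r G f where
  same: "\<forall>x \<in> verts G. g x = f x \<Longrightarrow> merges_to r G f g"
| step: "merges_to r G f g \<Longrightarrow> a \<in> g ` verts G \<Longrightarrow> b \<in> g ` verts G \<Longrightarrow> a \<noteq> b \<Longrightarrow>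
    \<forall>x \<in> verts G. h x = (if g x = b then a else g x) \<Longrightarrow> red_degree_le r G h \<Longrightarrow>
    merges_to r G f h"

lemma full_cong: "\<forall>x \<in> verts G. g x = f x \<Longrightarrow> full G g = full G f"
  unfolding full_def fun_eq_iff by (auto simp: image_iff)

lemma touching_cong: "\<forall>x \<in> verts G. g x = f x \<Longrightarrow> touching G g = touching G f"
  unfolding touching_def fun_eq_iff by auto

lemma mixed_cong: "\<forall>x \<in> verts G. g x = f x \<Longrightarrow> mixed G g = mixed G f"
  unfolding mixed_def fun_eq_iff using full_cong touching_cong by metis

lemma quotient_cong:
  assumes "\<forall>x \<in> verts G. g x = f x"
  shows "quotient G g = quotient G f"
proof -
  have "g ` verts G = f ` verts G"
    using assms by (intro image_cong) auto
  then show ?thesis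
    unfolding quotient_def full_cong[OF assms] mixed_cong[OF assms] by simp
qed

lemma red_degree_le_cong:
  assumes "\<forall>x \<in> verts G. g x = f x"
  shows "red_degree_le r G g \<longleftrightarrow> red_degree_le r G f"
  using assms unfolding red_degree_le_def mixed_cong[OF assms] by simp

lemma merges_to_cong:
  assumes "merges_to r G f g" "\<forall>x \<in> verts G. h x = g x"
  shows "merges_to r G f h"
  using assms
proof cases
  case same
  then show ?thesis using assms(2) by (auto intro: merges_to.same)
next
  case (step g' a b)
  have "red_degree_le r G h"
    using step red_degree_le_cong[OF assms(2)] by simp
  then show ?thesis
    using step assms(2) by (intro merges_to.step[of r G f g' a b h]) auto
qed

lemma merges_to_trans:
  assumes "merges_to r G g h" "merges_to r G f g"
  shows "merges_to r G f h"
  using assms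
proof induction
  case (same g')
  then show ?case by (auto intro: merges_to_cong)
next
  case (step g' a b h)
  then show ?case by (intro merges_to.step[of r G f g' a b h]) auto
qed

lemma merges_to_mono:
  assumes "merges_to r G f g" "r \<le> s"
  shows "merges_to s G f g"
  using assms(1)
proof induction
  case (same g)
  then show ?case by (rule merges_to.same)
next
  case (step g a b h)
  have "red_degree_le s G h"
    using step.hyps(6) assms(2) unfolding red_degree_le_def by (meson order_trans)
  then show ?case
    using step by (intro merges_to.step[of s G f g a b h]) auto
qed

text \<open>Every \<open>step\<close> already demands the bound for its result, so the bound for
  \<open>f\<close> is consulted only if no step was made.\<close>

lemma merges_to_red_degree_le:
  assumes "merges_to r G f g" "red_degree_le r G f"
  shows "red_degree_le r G g"
  using assms(1)
proof cases
  case same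
  then show ?thesis using red_degree_le_cong[of G g f r] assms(2) by simp
qed

lemma merges_to_image: "merges_to r G f g \<Longrightarrow> g ` verts G \<subseteq> f ` verts G"
  by (induction rule: merges_to.induct) (auto split: if_splits)

lemma image_merge:
  assumes "a \<in> g ` V" "b \<in> g ` V" "a \<noteq> b" "\<forall>x \<in> V. h x = (if g x = b then a else g x)"
  shows "h ` V = g ` V - {b}"
  using assms by (auto simp: image_iff split: if_splits)

text \<open>The labels are absorbed into \<open>a\<close> one at a time, \<open>B\<close> being
  those absorbed so far. All intermediate labellings take values among the labels of
  \<open>f\<close>, so the second hypothesis covers them. Absorbing \<open>a\<close> itself changes
  nothing.\<close>

lemma merges_to_constant:
  assumes "finite (verts G)" "\<And>g. g ` verts G \<subseteq> f ` verts G \<Longrightarrow> red_degree_le r G g"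
    and "a \<in> f ` verts G"
  shows "merges_to r G f (\<lambda>_. a)"
proof -
  have "merges_to r G f (\<lambda>x. if f x \<in> B then a else f x)"
    if "B \<subseteq> f ` verts G" for B
    using finite_subset[OF that finite_imageI[OF assms(1)]] that
  proof (induction B rule: finite_induct)
    case empty
    show ?case by (rule merges_to.same) simp
  next
    case (insert b B)
    let ?g = "\<lambda>x. if f x \<in> B then a else f x" and ?h = "\<lambda>x. if f x \<in> insert b B then a else f x"
    have IH: "merges_to r G f ?g" using insert by simp
    show ?case
    proof (cases "a = b")
      case True
      then show ?thesis by (intro merges_to_cong[OF IH]) auto
    next
      case False
      show ?thesis
      proof (rule merges_to.step[OF IH])
        show "a \<in> ?g ` verts G" using assms(3) by auto
        show "b \<in> ?g ` verts G" using insert by (auto simp: image_iff)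
        show "red_degree_le r G ?h" using assms(3) by (intro assms(2)) auto
      qed (use False insert in auto)
    qed
  qed
  from this[of "f ` verts G"] show ?thesis
    by (auto intro: merges_to_cong)
qed

text \<open>The trigraphs are indexed by their number of parts, as in \<open>d_sequence\<close>.
  Each merge removes exactly one label, so the induction extends the sequence by one index
  downwards.\<close>

lemma merges_to_trigraph_sequence:
  assumes "merges_to r G f g" "finite (verts G)" "red_degree_le r G f"
  shows "\<exists>S. S (card (f ` verts G)) = quotient G f \<and> S (card (g ` verts G)) = quotient G g \<and>
    (\<forall>i \<in> {card (g ` verts G)..card (f ` verts G)}. d_trigraph r (S i)) \<and>
    (\<forall>i \<in> {card (g ` verts G)<..card (f ` verts G)}. is_contraction (S i) (S (i - 1)))"
  using assms(1)
proof induction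
  case (same g)
  have "g ` verts G = f ` verts G"
    using same by (intro image_cong) auto
  then show ?case
    using quotient_cong[OF same] d_trigraph_quotient[OF assms(2,3)]
    by (intro exI[of _ "\<lambda>_. quotient G f"]) auto
next
  case (step g a b h)
  let ?n = "card (f ` verts G)" and ?m = "card (g ` verts G)"
  obtain S where S: "S ?n = quotient G f" "S ?m = quotient G g"
      "\<forall>i \<in> {?m..?n}. d_trigraph r (S i)" "\<forall>i \<in> {?m<..?n}. is_contraction (S i) (S (i - 1))"
    using step.IH by blast
  have m: "?m = Suc (card (h ` verts G))"
    unfolding image_merge[OF step.hyps(2-5)]
    using step.hyps(3) assms(2) by (intro card.remove) auto
  have mn: "?m \<le> ?n"
    using merges_to_image[OF step.hyps(1)] assms(2) by (simp add: card_mono)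
  let ?S = "S(card (h ` verts G) := quotient G h)"
  have c: "is_contraction (quotient G g) (quotient G h)"
    unfolding is_contraction_def
    using contract_quotient[OF step.hyps(2-5)] step.hyps(2-4)
    by (intro exI[of _ a] exI[of _ b]) (auto simp: quotient_def)
  show ?case
  proof (intro exI[of _ ?S] conjI ballI)
    show "?S ?n = quotient G f" using m mn S(1) by simp
    show "?S (card (h ` verts G)) = quotient G h" by simp
    fix i assume i: "i \<in> {card (h ` verts G)..?n}"
    show "d_trigraph r (?S i)"
      using i m S(3) d_trigraph_quotient[OF assms(2) step.hyps(6)] by auto
  next
    fix i assume i: "i \<in> {card (h ` verts G)<..?n}"
    show "is_contraction (?S i) (?S (i - 1))"
    proof (cases "i = ?m")
      case True
      then show ?thesis using m c S(2) by simp
    next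
      case False
      then have "i \<in> {?m<..?n}" using i m by auto
      then show ?thesis using m S(4) by auto
    qed
  qed
qed

lemma red_degree_le_id: "red_degree_le r G (\<lambda>x. x)"
proof -
  have "{b. mixed G (\<lambda>x. x) a b} = {}" for a
    using mixedD(4,5)[of G "\<lambda>x. x" a] by auto
  then show ?thesis by (simp add: red_degree_le_def)
qed

lemma d_sequence_if_merges_to_constant:
  assumes "simple_graph G" "verts G \<noteq> {}" "merges_to r G (\<lambda>x. x) (\<lambda>_. a)"
  shows "\<exists>S. d_sequence r G S"
proof -
  have fin: "finite (verts G)" using assms(1) by (simp add: simple_graph_def)
  have const: "(\<lambda>_. a) ` verts G = {a}" for a using assms(2) by auto
  obtain S where S: "S (card (verts G)) = quotient G (\<lambda>x. x)" "S 1 = quotient G (\<lambda>_. a)"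
      "\<forall>i \<in> {1..card (verts G)}. d_trigraph r (S i)"
      "\<forall>i \<in> {1<..card (verts G)}. is_contraction (S i) (S (i - 1))"
    using merges_to_trigraph_sequence[OF assms(3) fin red_degree_le_id] by (auto simp: const)
  have "quotient G (\<lambda>_. a) = of_graph (complete_graph {a})"
  proof -
    have "\<not> full G (\<lambda>_. a) x y" "\<not> mixed G (\<lambda>_. a) x y" for x y
      by (auto simp: full_def mixed_def touching_def)
    then show ?thesis
      by (simp add: quotient_def of_graph_def complete_graph_def all_edges_def const)
  qed
  then have "d_sequence r G S"
    unfolding d_sequence_def using S of_graph_quotient[OF assms(1)] by auto
  then show ?thesis by blast
qed

section \<open>Adjacency in Hamming graphs\<close>

text \<open>Adjacency without reference to \<open>d\<close> and \<open>k\<close>, so that it can be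
  analysed by recursion on lists.\<close>

definition hadj :: "nat list \<Rightarrow> nat list \<Rightarrow> bool" where
  "hadj xs ys \<longleftrightarrow> card {i. i < length xs \<and> xs ! i \<noteq> ys ! i} = 1"

lemma hadj_Nil: "\<not> hadj [] ys"
  by (simp add: hadj_def)

lemma hadj_Cons:
  assumes "length xs = length ys"
  shows "hadj (x # xs) (y # ys) \<longleftrightarrow> (if x = y then hadj xs ys else xs = ys)"
proof -
  have c: "card {i. i < length (x # xs) \<and> (x # xs) ! i \<noteq> (y # ys) ! i} =
      (if x \<noteq> y then 1 else 0) + card {i. i < length xs \<and> xs ! i \<noteq> ys ! i}"
    using card_Suc_filter[of "length xs" "\<lambda>i. (x # xs) ! i \<noteq> (y # ys) ! i"]
    unfolding length_Cons nth_Cons_0 nth_Cons_Suc .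
  show ?thesis
    unfolding hadj_def c differ_zero_iff[OF refl assms[symmetric], symmetric]
    by (cases "x = y") simp_all
qed

lemma hadj_irrefl: "\<not> hadj xs xs"
  by (simp add: hadj_def)

text \<open>The single differing position lies either in the suffix or in the prefix. This is the
  view of the graph as a product of two smaller Hamming graphs.\<close>

lemma hadj_append:
  assumes "length p = length q" "length s = length t"
  shows "hadj (p @ s) (q @ t) \<longleftrightarrow> p = q \<and> hadj s t \<or> hadj p q \<and> s = t"
  using assms by (induction p q rule: list_induct2) (auto simp: hadj_Nil hadj_Cons hadj_irrefl)

lemma mem_edges_hamming:
  assumes "xs \<in> verts (hamming d k)" "ys \<in> verts (hamming d k)"
  shows "{xs, ys} \<in> edges (hamming d k) \<longleftrightarrow> hadj xs ys"
proof (cases d)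
  case 0
  then have "xs = []" "ys = []"
    using assms by (auto simp: complete_graph_def)
  then show ?thesis
    using 0 singleton_notin_all_edges[of "[]"] by (simp add: complete_graph_def hadj_Nil)
next
  case Suc
  then show ?thesis
    using adjacent_hamming[OF _ assms] assms by (simp add: hadj_def verts_hamming)
qed

lemma finite_verts_hamming: "finite (verts (hamming d k))"
  using simple_graph_hamming by (auto simp: simple_graph_def)

lemma Nil_in_verts_hamming: "[] \<in> verts (hamming d k) \<longleftrightarrow> d = 0"
  by (auto simp: verts_hamming)

lemma Cons_in_verts_hamming:
  "x # xs \<in> verts (hamming (Suc d) k) \<longleftrightarrow> x < k \<and> xs \<in> verts (hamming d k)"
  by (auto simp: verts_hamming)

lemma append_in_verts_hamming:
  "length p = j \<Longrightarrow> p @ s \<in> verts (hamming (j + m) k) \<longleftrightarrow>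
    p \<in> verts (hamming j k) \<and> s \<in> verts (hamming m k)"
  by (auto simp: verts_hamming)

section \<open>Degrees and common neighbours in Hamming graphs\<close>

lemma card_hadj:
  "xs \<in> verts (hamming d k) \<Longrightarrow> card {ys \<in> verts (hamming d k). hadj xs ys} = d * (k - 1)"
proof (induction d arbitrary: xs)
  case 0
  then have "xs = []" by (simp add: complete_graph_def)
  then show ?case by (simp add: hadj_Nil)
next
  case (Suc d)
  then obtain x xs' where xs: "xs = x # xs'" "x < k" "xs' \<in> verts (hamming d k)"
    by (cases xs) (auto simp: Nil_in_verts_hamming Cons_in_verts_hamming)
  \<comment> \<open>Neighbours in \<open>?A\<close> keep the first coordinate, those in
    \<open>?B\<close> change it.\<close>
  let ?A = "(#) x ` {ys \<in> verts (hamming d k). hadj xs' ys}"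
  let ?B = "(\<lambda>y. y # xs') ` ({..<k} - {x})"
  have "{ys \<in> verts (hamming (Suc d) k). hadj xs ys} = ?A \<union> ?B"
  proof (rule set_eqI)
    fix ys
    show "ys \<in> {ys \<in> verts (hamming (Suc d) k). hadj xs ys} \<longleftrightarrow> ys \<in> ?A \<union> ?B"
    proof (cases ys)
      case Nil
      then show ?thesis by (auto simp: Nil_in_verts_hamming)
    next
      case (Cons y ys')
      show ?thesis
      proof (cases "ys' \<in> verts (hamming d k)")
        case True
        then have "length xs' = length ys'" using xs(3) by (simp add: verts_hamming)
        then show ?thesis
          using True xs Cons by (auto simp: Cons_in_verts_hamming hadj_Cons hadj_irrefl)
      next
        case False
        then show ?thesis
          using xs Cons by (auto simp: Cons_in_verts_hamming)
      qed
    qed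
  qed
  moreover have "card ?A = d * (k - 1)"
    using Suc.IH[OF xs(3)] by (simp add: card_image)
  moreover have "card ?B = k - 1"
    using xs(2) by (simp add: card_image inj_on_def)
  moreover have "?A \<inter> ?B = {}"
    by auto
  ultimately show ?case
    by (simp add: card_Un_disjoint finite_verts_hamming)
qed

text \<open>Induction on the coordinates. Equal heads and different tails: a common neighbour must
  keep the head, so the tails decide. Different heads and equal tails: only a third value of the
  head is possible. If both differ, only the two mixed corners \<open>x # ys'\<close> and
  \<open>y # xs'\<close> remain.\<close>

lemma card_common_neighbours:
  assumes "xs \<in> verts (hamming d k)" "ys \<in> verts (hamming d k)" "xs \<noteq> ys"
  shows "card {zs \<in> verts (hamming d k). hadj xs zs \<and> hadj ys zs} \<le>
    (if hadj xs ys then k - 2 else 2)"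
  using assms
proof (induction d arbitrary: xs ys)
  case 0
  then show ?case by (simp add: complete_graph_def)
next
  case (Suc d)
  obtain x xs' where xs: "xs = x # xs'" "x < k" "xs' \<in> verts (hamming d k)"
    using Suc.prems(1) by (cases xs) (auto simp: Nil_in_verts_hamming Cons_in_verts_hamming)
  obtain y ys' where ys: "ys = y # ys'" "y < k" "ys' \<in> verts (hamming d k)"
    using Suc.prems(2) by (cases ys) (auto simp: Nil_in_verts_hamming Cons_in_verts_hamming)
  let ?C = "{zs \<in> verts (hamming (Suc d) k). hadj xs zs \<and> hadj ys zs}"
  have C: "\<exists>z zs'. zs = z # zs' \<and> z < k \<and> zs' \<in> verts (hamming d k) \<and>
      (if x = z then hadj xs' zs' else xs' = zs') \<and> (if y = z then hadj ys' zs' else ys' = zs')"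
    if "zs \<in> ?C" for zs
  proof -
    obtain z zs' where zs: "zs = z # zs'" "z < k" "zs' \<in> verts (hamming d k)"
      using \<open>zs \<in> ?C\<close> by (cases zs) (auto simp: Nil_in_verts_hamming Cons_in_verts_hamming)
    moreover have "length xs' = length zs'" "length ys' = length zs'"
      using xs ys zs by (simp_all add: verts_hamming)
    ultimately show ?thesis
      using that unfolding xs(1) ys(1) by (simp add: hadj_Cons)
  qed
  have l: "length xs' = length ys'"
    using xs ys by (simp add: verts_hamming)
  consider (tail) "x = y" "xs' \<noteq> ys'" | (head) "x \<noteq> y" "xs' = ys'" | (both) "x \<noteq> y" "xs' \<noteq> ys'"
    using Suc.prems(3) xs(1) ys(1) by blast
  then show ?case
  proof cases
    case tail
    have "?C \<subseteq> (#) x ` {zs \<in> verts (hamming d k). hadj xs' zs \<and> hadj ys' zs}"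
      using C tail by (fastforce split: if_splits)
    then have "card ?C \<le> card {zs \<in> verts (hamming d k). hadj xs' zs \<and> hadj ys' zs}"
      by (rule surj_card_le[rotated]) (simp add: finite_verts_hamming)
    then show ?thesis
      using Suc.IH[OF xs(3) ys(3) tail(2)] tail(1) l unfolding xs(1) ys(1)
      by (simp add: hadj_Cons)
  next
    case head
    have "?C \<subseteq> (\<lambda>z. z # xs') ` ({..<k} - {x, y})"
      using C head hadj_irrefl by (fastforce split: if_splits)
    then have "card ?C \<le> card ({..<k} - {x, y})"
      by (rule surj_card_le[rotated]) simp
    also have "\<dots> = k - 2"
      using head xs ys by (subst card_Diff_subset) auto
    finally show ?thesis
      using head l unfolding xs(1) ys(1) by (simp add: hadj_Cons)
  next
    case both
    have "?C \<subseteq> {x # ys', y # xs'}"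
      using C both by (fastforce split: if_splits)
    then have "card ?C \<le> card {x # ys', y # xs'}"
      by (rule card_mono[rotated]) simp
    also have "\<dots> \<le> 2"
      by (simp add: card_insert_if)
    finally show ?thesis
      using both l unfolding xs(1) ys(1) by (simp add: hadj_Cons)
  qed
qed

section \<open>The lower bound\<close>

text \<open>A vertex outside \<open>{u, v}\<close> adjacent to exactly one of \<open>u\<close>,
  \<open>v\<close> yields a red edge at \<open>w\<close>, and distinct vertices yield distinct
  edges.\<close>

lemma card_red_contract:
  assumes "w \<in> tverts (contract (of_graph G) u v w)"
    and "d_trigraph r (contract (of_graph G) u v w)"
    and "A \<subseteq> {x. ({u, x} \<in> edges G) \<noteq> ({v, x} \<in> edges G)} - {u, v}"
  shows "card A \<le> r"
proof -
  let ?T = "contract (of_graph G) u v w"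
  have T: "trigraph ?T" "card {e \<in> red ?T. w \<in> e} \<le> r"
    using assms(1,2) by (auto simp: d_trigraph_def)
  have "red ?T \<subseteq> Pow (tverts ?T)" "finite (tverts ?T)"
    using T(1) by (auto simp: trigraph_def all_edges_def)
  then have fin: "finite {e \<in> red ?T. w \<in> e}"
    by (simp add: finite_subset)
  have "(\<lambda>x. {x, w}) ` A \<subseteq> {e \<in> red ?T. w \<in> e}"
    using assms(3) unfolding contract_def nbhd_def of_graph_def by auto
  moreover have "inj_on (\<lambda>x. {x, w}) A"
    by (auto simp: inj_on_def doubleton_eq_iff)
  ultimately have "card A \<le> card {e \<in> red ?T. w \<in> e}"
    using fin by (intro card_inj_on_le)
  then show ?thesis using T(2) by simp
qed

text \<open>The symmetric difference of the neighbourhoods has \<open>2 * (d * (k - 1))\<close>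
  elements minus twice the number of common neighbours. The loss is at most 4 for non-adjacent
  vertices. For adjacent ones it is at most \<open>2 * (k - 2)\<close>, plus 2 for \<open>u\<close>
  and \<open>v\<close> themselves. Adding the loss on the right avoids truncated
  subtraction.\<close>

lemma card_red_first_contraction:
  assumes "u \<in> verts (hamming d k)" "v \<in> verts (hamming d k)" "u \<noteq> v"
    and "d_trigraph r (contract (of_graph (hamming d k)) u v w)"
  shows "2 * (d * (k - 1)) \<le>
    r + (if hadj u v then 2 * (k - 2) + 2 else 4)"
proof -
  let ?V = "verts (hamming d k)"
  let ?N = "\<lambda>u. {x \<in> ?V. hadj u x}"
  let ?S = "(?N u - ?N v) \<union> (?N v - ?N u)"
  have fin: "finite (?N u)" "finite (?N v)" for u v
    by (simp_all add: finite_verts_hamming)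
  have sym: "hadj u v \<longleftrightarrow> hadj v u"
    using mem_edges_hamming[OF assms(1,2)] mem_edges_hamming[OF assms(2,1)]
    by (simp add: insert_commute)
  have c: "card (?N u \<inter> ?N v) \<le> (if hadj u v then k - 2 else 2)"
  proof -
    have "?N u \<inter> ?N v = {zs \<in> ?V. hadj u zs \<and> hadj v zs}" by blast
    then show ?thesis using card_common_neighbours[OF assms(1-3)] by simp
  qed
  have "card (?S - {u, v}) \<le> r"
  proof (rule card_red_contract[OF _ assms(4)])
    show "w \<in> tverts (contract (of_graph (hamming d k)) u v w)"
      by (simp add: contract_def)
    show "?S - {u, v} \<subseteq> {x. ({u, x} \<in> edges (hamming d k)) \<noteq> ({v, x} \<in> edges (hamming d k))} - {u, v}"
      using assms(1,2) by (auto simp: mem_edges_hamming)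
  qed
  \<comment> \<open>Adjacent \<open>u\<close> and \<open>v\<close> lie in each other's neighbourhood
    but not in their own, so they belong to \<open>?S\<close> without giving red edges. Otherwise
    neither is in \<open>?S\<close>.\<close>
  moreover have "card ?S \<le> card (?S - {u, v}) + (if hadj u v then 2 else 0)"
  proof (cases "hadj u v")
    case True
    have "card ?S \<le> card ((?S - {u, v}) \<union> {u, v})"
      using fin by (intro card_mono) auto
    also have "\<dots> \<le> card (?S - {u, v}) + card {u, v}"
      by (rule card_Un_le)
    finally show ?thesis using True assms(3) by simp
  next
    case False
    then have "?S - {u, v} = ?S"
      using sym hadj_irrefl by auto
    then show ?thesis by simp
  qed
  moreover have "card ?S = card (?N u - ?N v) + card (?N v - ?N u)"
    using fin by (intro card_Un_disjoint) auto
  moreover have "d * (k - 1) = card (?N u - ?N v) + card (?N u \<inter> ?N v)"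
    using card_Int_Diff[OF fin(1), of u "?N v"] card_hadj[OF assms(1)] by linarith
  moreover have "d * (k - 1) = card (?N v - ?N u) + card (?N u \<inter> ?N v)"
    using card_Int_Diff[OF fin(1), of v "?N u"] card_hadj[OF assms(2)]
    unfolding Int_commute[of "?N v"] by linarith
  moreover have "2 * n \<le> r + (if P then 2 * (k - 2) + 2 else 4)"
    if "a \<le> r" "s \<le> a + (if P then 2 else 0)" "s = p + q" "n = p + i" "n = q + i"
      "i \<le> (if P then k - 2 else 2)" for a s p q n i and P
    using that by (auto split: if_splits)
  ultimately show ?thesis
    using c by blast
qed

lemma hamming_lower_bound:
  assumes "d_sequence r (hamming d k) S" "2 \<le> card (verts (hamming d k))"
  shows "2 * (d * (k - 1)) \<le> r + max (2 * (k - 2) + 2) 4"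
proof -
  let ?n = "card (verts (hamming d k))"
  have "?n \<in> {2..?n}" "?n - 1 \<in> {1..?n}"
    using assms(2) by simp_all
  then have "is_contraction (of_graph (hamming d k)) (S (?n - 1))" "d_trigraph r (S (?n - 1))"
    using assms(1) unfolding d_sequence_def by metis+
  then obtain u v w where "u \<in> verts (hamming d k)" "v \<in> verts (hamming d k)" "u \<noteq> v"
      "d_trigraph r (contract (of_graph (hamming d k)) u v w)"
    unfolding is_contraction_def by (auto simp: of_graph_def)
  from card_red_first_contraction[OF this] show ?thesis
    by (auto split: if_splits)
qed

section \<open>The upper bound\<close>

text \<open>The labelling of the prefixes of length \<open>j\<close> may depend on the suffix, that is, on the copy
  of the first factor: this describes the moments at which only some copies have been treated.\<close>

definition lift :: "nat \<Rightarrow> (nat list \<Rightarrow> nat list \<Rightarrow> nat list) \<Rightarrow> nat list \<Rightarrow> nat list" where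
  "lift j g xs = g (drop j xs) (take j xs) @ drop j xs"

lemma lift_append: "length p = j \<Longrightarrow> lift j g (p @ s) = g s p @ s"
  by (simp add: lift_def)

lemma verts_hamming_appendE:
  assumes "xs \<in> verts (hamming (j + m) k)"
  obtains p s where "xs = p @ s" "length p = j" "length s = m"
    "p \<in> verts (hamming j k)" "s \<in> verts (hamming m k)"
proof
  show "xs = take j xs @ drop j xs" by simp
  show l: "length (take j xs) = j" "length (drop j xs) = m"
    using assms by (simp_all add: verts_hamming)
  show "take j xs \<in> verts (hamming j k)" "drop j xs \<in> verts (hamming m k)"
    using assms append_in_verts_hamming[OF l(1), of "drop j xs" m k] by simp_all
qed

text \<open>The moment at which exactly the copies in \<open>Y\<close> have undergone the merge of
  \<open>b\<close> into \<open>a\<close>. Inside its own copy a part has at most \<open>r\<close>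
  red neighbours. Edges to another copy preserve the prefix, and \<open>g\<close> and
  \<open>h\<close> differ by one merge only, so a part meets at most two parts in each of the
  \<open>m * (k - 1)\<close> adjacent copies.\<close>

lemma red_degree_le_lift:
  fixes j k m :: nat
  assumes g: "red_degree_le r (hamming j k) g" and h: "red_degree_le r (hamming j k) h"
    and hg: "\<forall>p \<in> verts (hamming j k). h p = (if g p = b then a else g p)" and "a \<noteq> b"
  shows "red_degree_le (r + 2 * (m * (k - 1))) (hamming (j + m) k)
    (lift j (\<lambda>s. if s \<in> Y then h else g))"
  unfolding red_degree_le_def
proof
  let ?P = "verts (hamming j k)" and ?Q = "verts (hamming m k)"
  let ?G = "hamming (j + m) k"
  define f where "f s = (if s \<in> Y then h else g)" for s
  fix l assume "l \<in> lift j (\<lambda>s. if s \<in> Y then h else g) ` verts ?G"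
  then obtain xs where "xs \<in> verts ?G" and xs: "l = lift j f xs"
    unfolding f_def by blast
  then obtain p s where ps: "xs = p @ s" "length p = j" "length s = m" "p \<in> ?P" "s \<in> ?Q"
    by (elim verts_hamming_appendE)
  define c where "c = f s p"
  have l: "l = c @ s"
    using xs ps by (simp add: lift_append c_def)
  \<comment> \<open>\<open>M t\<close> bounds the possible labels of parts in copy \<open>t\<close> that meet the part \<open>c\<close> of copy \<open>s\<close>.\<close>
  define M where "M t = (if t \<in> Y then {if c = b then a else c} else {c, b})" for t
  have dec: "\<exists>q. y = q @ t \<and> q \<in> ?P \<and> length q = j \<and> f t q = c'"
    if "y \<in> verts ?G" "lift j f y = c' @ t" "length t = m" for y c' t
    using that by (elim verts_hamming_appendE) (auto simp: lift_append)
  have mem: "c' \<in> M t" if "q \<in> ?P" "f s q = c" "f t q = c'" for q t c'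
    using that hg \<open>a \<noteq> b\<close> unfolding M_def f_def by (auto split: if_splits)
  have sub: "{l'. mixed ?G (lift j f) l l'} \<subseteq>
      (\<lambda>c'. c' @ s) ` {c'. mixed (hamming j k) (f s) c c'} \<union>
      (\<Union>t \<in> {t \<in> ?Q. hadj s t}. (\<lambda>c'. c' @ t) ` M t)"
  proof
    fix l' assume "l' \<in> {l'. mixed ?G (lift j f) l l'}"
    then have mx: "mixed ?G (lift j f) l l'" by simp
    obtain x y where xy: "x \<in> verts ?G" "y \<in> verts ?G" "lift j f x = l" "lift j f y = l'"
        "{x, y} \<in> edges ?G"
      using mixedD(4)[OF mx] by blast
    obtain q t where qt: "y = q @ t" "length q = j" "length t = m" "q \<in> ?P" "t \<in> ?Q"
      using xy(2) by (elim verts_hamming_appendE)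
    obtain p' where p': "x = p' @ s" "p' \<in> ?P" "length p' = j" "f s p' = c"
      using dec[OF xy(1)] xy(3) l ps(3) by blast
    have l': "l' = f t q @ t"
      using xy(4) qt by (simp add: lift_append)
    have adj: "p' = q \<and> hadj s t \<or> hadj p' q \<and> s = t"
      using xy(1,2,5) mem_edges_hamming[of x "j + m" k y] p' qt ps(3)
      by (simp add: hadj_append)
    show "l' \<in> (\<lambda>c'. c' @ s) ` {c'. mixed (hamming j k) (f s) c c'} \<union>
        (\<Union>t \<in> {t \<in> ?Q. hadj s t}. (\<lambda>c'. c' @ t) ` M t)"
    \<comment> \<open>Within one copy, both the edge and the non-edge of the mixed pair come from
      that copy and witness a mixed pair of \<open>f s\<close>. Between copies the edge alone
      suffices, as all touched parts are counted.\<close>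
    proof (cases "s = t")
      case True
      then have "hadj p' q"
        using adj hadj_irrefl by blast
      then have e: "{p', q} \<in> edges (hamming j k)"
        using p' qt mem_edges_hamming by blast
      obtain x' y' where xy': "x' \<in> verts ?G" "y' \<in> verts ?G" "lift j f x' = l"
          "lift j f y' = l'" "{x', y'} \<notin> edges ?G"
        using mixedD(5)[OF mx] by blast
      obtain p2 where p2: "x' = p2 @ s" "p2 \<in> ?P" "length p2 = j" "f s p2 = c"
        using dec[OF xy'(1)] xy'(3) l ps(3) by blast
      obtain q2 where q2: "y' = q2 @ t" "q2 \<in> ?P" "length q2 = j" "f t q2 = f t q"
        using dec[OF xy'(2)] xy'(4) l' qt(3) by blast
      have "\<not> hadj p2 q2"
        using xy'(1,2,5) mem_edges_hamming[of x' "j + m" k y'] p2 q2 ps(3) True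
        by (simp add: hadj_append)
      then have ne: "{p2, q2} \<notin> edges (hamming j k)"
        using p2 q2 mem_edges_hamming by blast
      have "c \<noteq> f s q"
        using mixedD(1)[OF mx] l l' True by auto
      then have "mixed (hamming j k) (f s) c (f s q)"
        using e ne p' p2 q2 qt(4) True unfolding mixed_def touching_def full_def by blast
      then show ?thesis using l' True by blast
    next
      case False
      then have "p' = q" "hadj s t" using adj by auto
      then have "f t q \<in> M t" using mem p' by blast
      then show ?thesis using l' qt(5) \<open>hadj s t\<close> by blast
    qed
  qed
  have c: "c \<in> f s ` ?P"
    using ps(4) by (simp add: c_def)
  have "card {c'. mixed (hamming j k) (f s) c c'} \<le> r"
    using c g h unfolding red_degree_le_def f_def by (auto split: if_splits)
  moreover have fin: "finite {c'. mixed (hamming j k) (f s) c c'}"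
    by (rule finite_subset[of _ "f s ` ?P"]) (use mixedD(3) finite_verts_hamming in auto)
  ultimately have 1: "card ((\<lambda>c'. c' @ s) ` {c'. mixed (hamming j k) (f s) c c'}) \<le> r"
    using card_image_le order_trans by blast
  have M: "finite (M t)" "card (M t) \<le> 2" for t
    by (simp_all add: M_def card_insert_if)
  have fQ: "finite {t \<in> ?Q. hadj s t}"
    by (simp add: finite_verts_hamming)
  have "card (\<Union>t \<in> {t \<in> ?Q. hadj s t}. (\<lambda>c'. c' @ t) ` M t) \<le>
      (\<Sum>t \<in> {t \<in> ?Q. hadj s t}. card ((\<lambda>c'. c' @ t) ` M t))"
    by (rule card_UN_le[OF fQ])
  also have "\<dots> \<le> (\<Sum>t \<in> {t \<in> ?Q. hadj s t}. 2)"
    using M card_image_le order_trans by (intro sum_mono) blast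
  also have "\<dots> = 2 * (m * (k - 1))"
    using card_hadj[OF ps(5)] by simp
  finally have 2: "card (\<Union>t \<in> {t \<in> ?Q. hadj s t}. (\<lambda>c'. c' @ t) ` M t) \<le> 2 * (m * (k - 1))" .
  have "card {l'. mixed ?G (lift j f) l l'} \<le>
      card ((\<lambda>c'. c' @ s) ` {c'. mixed (hamming j k) (f s) c c'} \<union>
        (\<Union>t \<in> {t \<in> ?Q. hadj s t}. (\<lambda>c'. c' @ t) ` M t))"
    using sub fin fQ M(1) by (intro card_mono) auto
  also have "\<dots> \<le> r + 2 * (m * (k - 1))"
    using 1 2 by (meson add_mono card_Un_le order_trans)
  finally show "card {l'. mixed ?G (lift j (\<lambda>s. if s \<in> Y then h else g)) l l'} \<le>
      r + 2 * (m * (k - 1))"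
    unfolding f_def .
qed

lemma merges_to_lift:
  assumes "merges_to r (hamming j k) f g" "red_degree_le r (hamming j k) f"
  shows "merges_to (r + 2 * (m * (k - 1))) (hamming (j + m) k)
    (lift j (\<lambda>_. f)) (lift j (\<lambda>_. g))"
  using assms(1)
proof induction
  case (same g)
  show ?case
    by (rule merges_to.same) (auto elim!: verts_hamming_appendE simp: lift_append same)
next
  case (step g a b h)
  let ?Q = "verts (hamming m k)"
  let ?L = "\<lambda>Y. lift j (\<lambda>s. if s \<in> Y then h else g)"
  have g: "red_degree_le r (hamming j k) g"
    using merges_to_red_degree_le[OF step.hyps(1) assms(2)] .
  \<comment> \<open>Inner induction on the set \<open>Y\<close> of treated copies: treating copy
    \<open>s\<close> merges \<open>b @ s\<close> into \<open>a @ s\<close>. With all copies treated,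
    the lifted \<open>h\<close> is reached.\<close>
  have "merges_to (r + 2 * (m * (k - 1))) (hamming (j + m) k) (lift j (\<lambda>_. f)) (?L Y)"
    if "Y \<subseteq> ?Q" for Y
    using finite_subset[OF that finite_verts_hamming] that
  proof (induction Y rule: finite_induct)
    case empty
    show ?case using step.IH by simp
  next
    case (insert s Y)
    obtain p q where pq: "a = g p" "p \<in> verts (hamming j k)" "b = g q" "q \<in> verts (hamming j k)"
      using step.hyps(2,3) by blast
    have l: "length p = j" "length q = j"
      using pq by (simp_all add: verts_hamming)
    have IH: "merges_to (r + 2 * (m * (k - 1))) (hamming (j + m) k) (lift j (\<lambda>_. f)) (?L Y)"
      using insert by simp
    show ?case
    proof (rule merges_to.step[OF IH])
      show "a @ s \<in> ?L Y ` verts (hamming (j + m) k)"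
        using insert.hyps(2) insert.prems pq l
        by (intro image_eqI[of _ _ "p @ s"]) (auto simp: lift_append append_in_verts_hamming)
      show "b @ s \<in> ?L Y ` verts (hamming (j + m) k)"
        using insert.hyps(2) insert.prems pq l
        by (intro image_eqI[of _ _ "q @ s"]) (auto simp: lift_append append_in_verts_hamming)
      show "a @ s \<noteq> b @ s" using step.hyps(4) by simp
      show "\<forall>x \<in> verts (hamming (j + m) k).
          ?L (insert s Y) x = (if ?L Y x = b @ s then a @ s else ?L Y x)"
      proof
        fix x assume "x \<in> verts (hamming (j + m) k)"
        then obtain p' t where pt: "x = p' @ t" "length p' = j" "length t = m"
            "p' \<in> verts (hamming j k)"
          by (elim verts_hamming_appendE)
        have "length s = m" using insert.prems by (auto simp: verts_hamming)
        then show "?L (insert s Y) x = (if ?L Y x = b @ s then a @ s else ?L Y x)"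
          using pt step.hyps(5) insert.hyps(2) by (auto simp: lift_append)
      qed
      show "red_degree_le (r + 2 * (m * (k - 1))) (hamming (j + m) k) (?L (insert s Y))"
        by (rule red_degree_le_lift[OF g step.hyps(6,5,4)])
    qed
  qed
  then have "merges_to (r + 2 * (m * (k - 1))) (hamming (j + m) k) (lift j (\<lambda>_. f)) (?L ?Q)"
    by blast
  then show ?case
    by (rule merges_to_cong) (auto elim!: verts_hamming_appendE simp: lift_append)
qed

section \<open>Collapsing the coordinates one after another\<close>

lemma red_degree_le_card_image:
  assumes "finite (verts G)" "card (f ` verts G) \<le> Suc r"
  shows "red_degree_le r G f"
  unfolding red_degree_le_def
proof
  fix a assume a: "a \<in> f ` verts G"
  have "{b. mixed G f a b} \<subseteq> f ` verts G - {a}"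
    using mixedD(1,3)[of G f a] by blast
  then have "card {b. mixed G f a b} \<le> card (f ` verts G - {a})"
    using assms(1) by (simp add: card_mono)
  then show "card {b. mixed G f a b} \<le> r"
    using a assms by simp
qed

lemma zeros_in_verts_hamming: "k \<ge> 1 \<Longrightarrow> replicate d 0 \<in> verts (hamming d k)"
  by (auto simp: verts_hamming)

text \<open>Once the first \<open>j\<close> coordinates are collapsed, a copy of the factor on
  \<open>Suc j\<close> coordinates has at most \<open>k\<close> parts. Any further merging inside it
  thus has red degree at most \<open>k - 1\<close>, and \<open>merges_to_lift\<close> transfers the
  collapse to all copies.\<close>

lemma merges_to_lift_zeros_Suc:
  assumes "k \<ge> 1"
  shows "merges_to (k - 1 + 2 * (m * (k - 1))) (hamming (Suc j + m) k)
    (lift j (\<lambda>_ _. replicate j 0)) (lift (Suc j) (\<lambda>_ _. replicate (Suc j) 0))"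
proof -
  let ?G = "hamming (Suc j) k" and ?f = "lift j (\<lambda>_ _. replicate j 0)"
  have "?f ` verts ?G \<subseteq> (\<lambda>x. replicate j 0 @ [x]) ` {..<k}"
  proof
    fix l assume "l \<in> ?f ` verts ?G"
    then obtain xs where "xs \<in> verts (hamming (j + 1) k)" "l = ?f xs" by auto
    then show "l \<in> (\<lambda>x. replicate j 0 @ [x]) ` {..<k}"
      by (elim verts_hamming_appendE)
        (auto simp: lift_append length_Suc_conv verts_hamming simp del: hamming.simps)
  qed
  then have "card (?f ` verts ?G) \<le> card {..<k}"
    by (rule surj_card_le[rotated]) simp
  then have "red_degree_le (k - 1) ?G g" if "g ` verts ?G \<subseteq> ?f ` verts ?G" for g
    using card_mono[OF _ that] assms
    by (intro red_degree_le_card_image) (simp_all add: finite_verts_hamming)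
  moreover have "replicate (Suc j) 0 \<in> ?f ` verts ?G"
  proof (rule image_eqI)
    have "replicate (Suc j) (0 :: nat) = replicate j 0 @ [0]"
      by (simp add: replicate_append_same)
    then show "replicate (Suc j) 0 = ?f (replicate (Suc j) 0)"
      by (simp only: lift_append length_replicate)
  qed (rule zeros_in_verts_hamming[OF assms])
  ultimately have "merges_to (k - 1) ?G ?f (\<lambda>_. replicate (Suc j) 0)" "red_degree_le (k - 1) ?G ?f"
    by (auto intro: merges_to_constant finite_verts_hamming)
  then have "merges_to (k - 1 + 2 * (m * (k - 1))) (hamming (Suc j + m) k)
      (lift (Suc j) (\<lambda>_. ?f)) (lift (Suc j) (\<lambda>_ _. replicate (Suc j) 0))"
    by (rule merges_to_lift)
  \<comment> \<open>Lifting \<open>?f\<close> from prefixes of length \<open>Suc j\<close> gives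
    \<open>?f\<close> again: it always zeroes the first \<open>j\<close> entries and keeps the
    rest.\<close>
  moreover have "merges_to (k - 1 + 2 * (m * (k - 1))) (hamming (Suc j + m) k)
      ?f (lift (Suc j) (\<lambda>_. ?f))"
  proof (rule merges_to.same, rule ballI)
    fix xs :: "nat list"
    have "drop j (take (Suc j) xs) @ drop (Suc j) xs = drop j xs"
      using append_take_drop_id[of 1 "drop j xs"] by (simp add: drop_take)
    then show "lift (Suc j) (\<lambda>_. ?f) xs = ?f xs"
      by (simp add: lift_def)
  qed
  ultimately show ?thesis
    by (rule merges_to_trans)
qed

lemma hamming_upper_bound:
  assumes "merges_to 0 (hamming j k) (\<lambda>x. x) (\<lambda>_. replicate j 0)" "j \<le> d" "k \<ge> 1"
  shows "\<exists>S. d_sequence (2 * ((d - j) * (k - 1))) (hamming d k) S"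
proof -
  let ?r = "2 * ((d - j) * (k - 1))"
  have "merges_to ?r (hamming d k) (\<lambda>x. x) (lift i (\<lambda>_ _. replicate i 0))"
    if "j \<le> i" "i \<le> d" for i
    using that
  proof (induction i rule: dec_induct)
    case base
    have "merges_to ?r (hamming d k) (lift j (\<lambda>_ x. x)) (lift j (\<lambda>_ _. replicate j 0))"
      using merges_to_lift[OF assms(1) red_degree_le_id, of "d - j"] assms(2) by simp
    moreover have "merges_to ?r (hamming d k) (\<lambda>x. x) (lift j (\<lambda>_ x. x))"
      by (rule merges_to.same) (simp add: lift_def)
    ultimately show ?case by (rule merges_to_trans)
  next
    case (step i)
    define m where "m = d - Suc i"
    have d: "d = Suc i + m"
      using step by (simp add: m_def)
    \<comment> \<open>Only \<open>m\<close> coordinates index the copies here, and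
      \<open>Suc m = d - i\<close> is at most \<open>d - j\<close>. The coordinate being collapsed
      leaves room for \<open>2 * (k - 1)\<close>, more than enough for the \<open>k - 1\<close> red
      neighbours in the own copy.\<close>
    have "k - 1 + 2 * (m * (k - 1)) \<le> 2 * ((Suc m) * (k - 1))"
      by simp
    also have "\<dots> \<le> ?r"
      using step.hyps d by (intro mult_le_mono) simp_all
    finally have "merges_to ?r (hamming d k) (lift i (\<lambda>_ _. replicate i 0))
        (lift (Suc i) (\<lambda>_ _. replicate (Suc i) 0))"
      using merges_to_mono[OF merges_to_lift_zeros_Suc[OF assms(3), of m i]] d by simp
    then show ?case
      by (rule merges_to_trans) (use step in simp)
  qed
  from this[of d] have "merges_to ?r (hamming d k) (\<lambda>x. x) (\<lambda>_. replicate d 0)"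
    using assms(2) by (auto intro: merges_to_cong simp: lift_def verts_hamming)
  moreover have "verts (hamming d k) \<noteq> {}"
    using zeros_in_verts_hamming[OF assms(3)] by blast
  ultimately show ?thesis
    using d_sequence_if_merges_to_constant[OF simple_graph_hamming] by blast
qed

section \<open>Factors that collapse without red edges\<close>

lemma red_degree_le_0I:
  assumes "\<And>x y x' y'. x \<in> verts G \<Longrightarrow> y \<in> verts G \<Longrightarrow> x' \<in> verts G \<Longrightarrow> y' \<in> verts G \<Longrightarrow>
    f x = f x' \<Longrightarrow> f y = f y' \<Longrightarrow> f x \<noteq> f y \<Longrightarrow> {x, y} \<in> edges G \<Longrightarrow> {x', y'} \<in> edges G"
  shows "red_degree_le 0 G f"
proof -
  have "{b. mixed G f a b} = {}" for a
    using assms mixedD(1,4,5)[of G f a] by (metis (mono_tags, lifting) Collect_empty_eq)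
  then show ?thesis by (simp add: red_degree_le_def)
qed

lemma merges_to_complete:
  assumes "k \<ge> 1"
  shows "merges_to 0 (hamming 1 k) (\<lambda>x. x) (\<lambda>_. replicate 1 0)"
proof (rule merges_to_constant)
  fix g :: "nat list \<Rightarrow> nat list"
  have "{x, y} \<in> edges (hamming 1 k)"
    if "x \<in> verts (hamming 1 k)" "y \<in> verts (hamming 1 k)" "x \<noteq> y" for x y
    using that mem_edges_hamming[OF that(1,2)] unfolding verts_hamming
    by (auto simp: length_Suc_conv hadj_Cons simp del: hamming.simps split: if_splits)
  then show "red_degree_le 0 (hamming 1 k) g"
    by (intro red_degree_le_0I) metis
  show "replicate 1 0 \<in> (\<lambda>x. x) ` verts (hamming 1 k)"
    unfolding image_ident by (rule zeros_in_verts_hamming[OF assms])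
qed (rule finite_verts_hamming)

lemma merges_to_4_cycle:
  "merges_to 0 (hamming 2 2) (\<lambda>x. x) (\<lambda>_. replicate 2 0)"
proof -
  let ?G = "hamming 2 2"
  have V: "verts ?G = {[0, 0], [0, 1], [1, 0], [1, 1]}"
    by (auto simp: verts_hamming length_Suc_conv numeral_2_eq_2 less_Suc_eq simp del: hamming.simps)
  \<comment> \<open>Opposite vertices of the cycle are twins, so they are merged first.\<close>
  define g1 g2 where "g1 x = (if x = [1, 1] then [0, 0] else x)"
    and "g2 x = (if g1 x = [1, 0] then [0, 1] else g1 x)" for x :: "nat list"
  \<comment> \<open>The 4-cycle is complete bipartite with sides \<open>{[0, 0], [1, 1]}\<close> and
    \<open>{[0, 1], [1, 0]}\<close>. So a labelling whose parts stay within the sides has no mixed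
    pair.\<close>
  have E: "{x, y} \<in> edges ?G \<longleftrightarrow> (x \<in> {[0, 0], [1, 1]}) \<noteq> (y \<in> {[0, 0], [1, 1]})"
    if "x \<in> verts ?G" "y \<in> verts ?G" for x y
    using that unfolding mem_edges_hamming[OF that] unfolding V
    by (auto simp: hadj_Cons hadj_irrefl)
  have r: "red_degree_le 0 ?G g"
    if "\<forall>x \<in> verts ?G. \<forall>y \<in> verts ?G. g x = g y \<longrightarrow>
      (x \<in> {[0, 0], [1, 1]} \<longleftrightarrow> y \<in> {[0, 0], [1, 1]})" for g :: "nat list \<Rightarrow> nat list"
  proof (rule red_degree_le_0I)
    fix x y x' y'
    assume *: "x \<in> verts ?G" "y \<in> verts ?G" "x' \<in> verts ?G" "y' \<in> verts ?G"
      "g x = g x'" "g y = g y'" "{x, y} \<in> edges ?G"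
    then have "x \<in> {[0, 0], [1, 1]} \<longleftrightarrow> x' \<in> {[0, 0], [1, 1]}"
        "y \<in> {[0, 0], [1, 1]} \<longleftrightarrow> y' \<in> {[0, 0], [1, 1]}"
      using that by blast+
    then show "{x', y'} \<in> edges ?G"
      using *(7) unfolding E[OF *(1,2)] E[OF *(3,4)] by blast
  qed
  have "red_degree_le 0 ?G g1" "red_degree_le 0 ?G g2"
    by (rule r, simp add: V g1_def g2_def)+
  moreover from this(1) have "merges_to 0 ?G (\<lambda>x. x) g1"
    by (intro merges_to.step[OF merges_to.same, of _ "\<lambda>x. x" _ "[0, 0]" "[1, 1]"])
      (simp_all add: V g1_def)
  ultimately have "merges_to 0 ?G (\<lambda>x. x) g2"
    by (intro merges_to.step[of _ _ _ g1 "[0, 1]" "[1, 0]" g2]) (simp_all add: V g1_def g2_def)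
  \<comment> \<open>The last merge joins the two sides; a single part has no red edge.\<close>
  then have "merges_to 0 ?G (\<lambda>x. x) (\<lambda>_. [0, 0])"
    by (rule merges_to.step[of _ _ _ _ "[0, 0]" "[0, 1]"])
      (auto simp: V g1_def g2_def intro!: red_degree_le_0I)
  then show ?thesis
    by (simp add: numeral_2_eq_2 del: hamming.simps)
qed

section \<open>The twin-width of Hamming graphs\<close>

lemma twin_width_eqI:
  assumes "\<exists>S. d_sequence r G S" "\<And>s S. d_sequence s G S \<Longrightarrow> r \<le> s"
  shows "twin_width G = r"
  unfolding twin_width_def using assms by (intro Least_equality) auto

theorem proposition3p3:
  fixes d k :: nat
  assumes "d \<ge> 1" and "k \<ge> 1"
  shows "twin_width (hamming d k) =
    (if d = 1 \<or> k = 1 then 0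
     else if k = 2 then 2 * (k - 1) * (d - 2)
     else 2 * (k - 1) * (d - 1))"
proof (cases "d = 1 \<or> k = 1")
  case True
  \<comment> \<open>The bound \<open>2 * ((d - 1) * (k - 1))\<close> for \<open>j = 1\<close>
    vanishes in both cases.\<close>
  then have "\<exists>S. d_sequence 0 (hamming d k) S"
    using hamming_upper_bound[OF merges_to_complete assms] assms by auto
  then show ?thesis
    using True by (auto intro: twin_width_eqI)
next
  case False
  then have dk: "d \<ge> 2" "k \<ge> 2" using assms by auto
  have "card (verts (hamming d k)) = k ^ d"
    using card_lists_length_eq[of "{..<k}" d] by (simp add: verts_hamming conj_commute)
  also have "\<dots> \<ge> k"
    using dk by (intro self_le_power) simp_all
  \<comment> \<open>Having at least \<open>k\<close>, hence at least two, vertices guarantees a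
    first contraction. The maximum is 4 for \<open>k = 2\<close>, attained by non-adjacent pairs,
    and \<open>2 * (k - 1)\<close> for \<open>k \<ge> 3\<close>.\<close>
  finally have lower: "2 * (d * (k - 1)) \<le> s + max (2 * (k - 2) + 2) 4"
    if "d_sequence s (hamming d k) S" for s S
    using hamming_lower_bound[OF that] dk by simp
  show ?thesis
  proof (cases "k = 2")
    case True
    have "\<exists>S. d_sequence (2 * (d - 2)) (hamming d k) S"
      using hamming_upper_bound[of 2 2 d] merges_to_4_cycle dk True by simp
    moreover have "2 * (d - 2) \<le> s" if "d_sequence s (hamming d k) S" for s S
      using lower[OF that] True by simp
    ultimately show ?thesis
      using False True by (simp add: twin_width_eqI)
  next
    case k: False
    have "\<exists>S. d_sequence (2 * (k - 1) * (d - 1)) (hamming d k) S"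
      using hamming_upper_bound[OF merges_to_complete assms] assms by (simp add: ac_simps)
    moreover have "2 * (k - 1) * (d - 1) \<le> s" if "d_sequence s (hamming d k) S" for s S
    proof -
      \<comment> \<open>This substitution removes the truncated subtractions and resolves the
        maximum to its first argument.\<close>
      obtain e l where "d = Suc e" "k = l + 3"
        using that[of "d - 1" "k - 3"] dk k by simp
      then show ?thesis
        using lower[OF that] by (simp add: algebra_simps)
    qed
    ultimately show ?thesis
      using False k by (simp add: twin_width_eqI)
  qed
qed

end
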